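(* Let $P\subset\mathbb{R}^n$ be a simplicial lattice polytope containing the origin as an interior point, and let $\mathrm{MHS}_{\mathrm{orb}}$ be the mixed Hodge structure on $H^{2*}_{\mathrm{orb}}(\mathcal{X})$ defined by a Poincaré–Lefschetz conjugation. Then $\mathrm{MHS}_{\mathrm{orb}}$ is of Hodge–Tate type (that is, $h^{p,q}:=\dim\mathrm{gr}_F^p\mathrm{gr}^W_{p+q}H^{2*}_{\mathrm{orb}}(\mathcal{X})=0$ whenever $p\neq q$) if and only if $[i_\ell]=[i_{\ell^{-1}}]$ for all $\ell\in F$.
   Context: **Orbifold cohomology.** $\mathcal{V}(P)$ is the set of vertices of $P$, $\Sigma_P$ the fan of cones over the faces of $P$, $\mathcal{X}$ the toric Deligne–Mumford stack (Borisov–Chen–Smith) of the stacky fan $(\mathbb{Z}^n,\Sigma_P,\mathcal{V}(P))$. For $\sigma\in\Sigma_P$, $\mathrm{Box}(\sigma)$ is the set of $v\in\mathbb{Z}^n$ of the form $v=\sum q_bb$, sum over the vertices $b$ of $P$ generating the rays of $\sigma$, with all $0<q_b<1$ (so $\mathrm{Box}(\{0\})=\{0\}$). The set of labels of the sectors is $F=\bigcup_\sigma\mathrm{Box}(\sigma)$. For $\ell=\sum q_bb\in F$: $\sigma(\ell)$ is the smallest cone containing $\ell$; $X_\ell$ (underlying space of the sector) is the simplicial toric variety of the quotient fan $\Sigma_P/\sigma(\ell)$; $n_\ell=\dim X_\ell=n-\dim\sigma(\ell)$; the age is $i_\ell=\sum q_b$; $\ell^{-1}=\sum(1-q_b)b\in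 F$. One has $n_\ell+i_\ell+i_{\ell^{-1}}=n$. $H^k(X_\ell)$ means $H^k(X_\ell;\mathbb{C})$ and $H^{2\alpha}_{\mathrm{orb}}(\mathcal{X})=\bigoplus_{\ell\in F}H^{2(\alpha-i_\ell)}(X_\ell)$, $\alpha\in\mathbb{Q}$ (summands are $0$ unless $\alpha-i_\ell\in\mathbb{Z}_{\ge0}$). $[x]$ is the integer part. **Filtrations.** For $p,m\in\mathbb{Z}$: if $i_\ell\in\mathbb{Z}$, $F^pH^{2*}(X_\ell)=\bigoplus_{i\ge p}H^{2(n-i-i_\ell)}(X_\ell)$ and $W_mH^{2*}(X_\ell)=\bigoplus_{n+n_\ell-m\le2j}H^{2j}(X_\ell)$; if $i_\ell\notin\mathbb{Z}$, $F^pH^{2*}(X_\ell)=\bigoplus_{i\ge p}H^{2(n-1-i-[i_\ell])}(X_\ell)$ and $W_mH^{2*}(X_\ell)=\bigoplus_{n-1+n_\ell-m\le2j}H^{2j}(X_\ell)$. $F^p$ and $W_m$ on $H^{2*}_{\mathrm{orb}}(\mathcal{X})$ are the direct sums over $\ell\in F$. **Mixed Hodge structure.** A Poincaré–Lefschetz conjugation is a $\mathbb{C}$-antilinear involution with $\overline{H^{2i}(X_\ell)}\subset\bigoplus_{j\ge i}H^{2j}(X_{\ell^{-1}})$ for all $\ell\in F$ and all $i$. $\mathrm{MHS}_{\mathrm{orb}}$ consists of $H^{2*}_{\mathrm{orb}}(\mathcal{X})$, the real form fixed by the conjugation, $F^\bullet$ and $W_\bullet$. *)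

theory Defs
  imports "HOL-Analysis.Analysis" "HOL-Homology.Homology" "HOL-Algebra.Module" "HOL-Algebra.AbelCoset"
    "HOL-Library.Extended_Nat"
begin

section \<open>Complex vector spaces as carriers\<close>

text \<open>
  Complex vector spaces are records of type \<^typ>\<open>(complex, 'v) module\<close>.  The fields
  \<^const>\<open>mult\<close> and \<^const>\<open>one\<close>, inherited from the ring record, are never used.
\<close>

definition quotient_module :: "(complex, 'v) module \<Rightarrow> 'v set \<Rightarrow> (complex, 'v set) module" where
  "quotient_module V U =
     \<lparr>carrier = A_RCOSETS V U, mult = undefined, one = undefined,
      zero = U, add = set_add V,
      smult = (\<lambda>c X. \<Union>x\<in>X. U +>\<^bsub>V\<^esub> (c \<odot>\<^bsub>V\<^esub> x))\<rparr>"

definition direct_sum_module ::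
  "'i set \<Rightarrow> ('i \<Rightarrow> (complex, 'v) module) \<Rightarrow> (complex, 'i \<Rightarrow> 'v) module" where
  "direct_sum_module I V =
     \<lparr>carrier = {x \<in> \<Pi>\<^sub>E i\<in>I. carrier (V i). finite {i \<in> I. x i \<noteq> \<zero>\<^bsub>V i\<^esub>}},
      mult = undefined, one = undefined,
      zero = (\<lambda>i\<in>I. \<zero>\<^bsub>V i\<^esub>),
      add = (\<lambda>x y. \<lambda>i\<in>I. x i \<oplus>\<^bsub>V i\<^esub> y i),
      smult = (\<lambda>c x. \<lambda>i\<in>I. c \<odot>\<^bsub>V i\<^esub> x i)\<rparr>"

text \<open>The partial sum over \<open>i \<in> I \<inter> J\<close>, as a subspace of the direct sum over \<open>I\<close>.\<close>

definition partial_sum :: "'i set \<Rightarrow> ('i \<Rightarrow> (complex, 'v) module) \<Rightarrow> 'i set \<Rightarrow> ('i \<Rightarrow> 'v) set" where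
  "partial_sum I V J =
     {x \<in> carrier (direct_sum_module I V). \<forall>i\<in>I - J. x i = \<zero>\<^bsub>V i\<^esub>}"

definition finite_basis :: "(complex, 'v) module \<Rightarrow> 'v set \<Rightarrow> bool" where
  "finite_basis V B \<longleftrightarrow> finite B \<and> B \<subseteq> carrier V \<and>
     (\<forall>x\<in>carrier V. \<exists>!c. c \<in> extensional B \<and> x = finsum V (\<lambda>b. c b \<odot>\<^bsub>V\<^esub> b) B)"

text \<open>
  All finite bases have the same cardinality, so the infimum only serves to give the value
  \<open>\<infinity>\<close> (the infimum of the empty set) to infinite-dimensional spaces; in particular
  dimension \<open>0\<close> means that the space is trivial.
\<close>

definition vdim :: "(complex, 'v) module \<Rightarrow> enat" where
  "vdim V = (INF B\<in>{B. finite_basis V B}. enat (card B))"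

section \<open>Singular cohomology with complex coefficients\<close>

type_synonym 'x cochain = "((nat \<Rightarrow> real) \<Rightarrow> 'x) \<Rightarrow> complex"

text \<open>
  A \<open>k\<close>-cochain is a complex function on the singular \<open>k\<close>-simplices, extended by \<open>0\<close> to
  the functions that are not singular \<open>k\<close>-simplices.
\<close>

definition cochains :: "nat \<Rightarrow> 'x topology \<Rightarrow> (complex, 'x cochain) module" where
  "cochains k X =
     \<lparr>carrier = {\<phi>. \<forall>f. \<not> singular_simplex k X f \<longrightarrow> \<phi> f = 0},
      mult = undefined, one = undefined,
      zero = (\<lambda>f. 0),
      add = (\<lambda>\<phi> \<psi> f. \<phi> f + \<psi> f),
      smult = (\<lambda>c \<phi> f. c * \<phi> f)\<rparr>"

definition coboundary :: "nat \<Rightarrow> 'x topology \<Rightarrow> 'x cochain \<Rightarrow> 'x cochain" where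
  "coboundary k X \<phi> =
     (\<lambda>f. if singular_simplex (Suc k) X f
          then \<Sum>i\<le>Suc k. (-1) ^ i * \<phi> (singular_face (Suc k) i f) else 0)"

definition cocycles :: "nat \<Rightarrow> 'x topology \<Rightarrow> 'x cochain set" where
  "cocycles k X = {\<phi> \<in> carrier (cochains k X). coboundary k X \<phi> = (\<lambda>f. 0)}"

definition coboundaries :: "nat \<Rightarrow> 'x topology \<Rightarrow> 'x cochain set" where
  "coboundaries k X =
     (case k of 0 \<Rightarrow> {\<lambda>f. 0} | Suc i \<Rightarrow> coboundary i X ` carrier (cochains i X))"

definition cohomology :: "nat \<Rightarrow> 'x topology \<Rightarrow> (complex, 'x cochain set) module" where
  "cohomology k X =
     quotient_module ((cochains k X)\<lparr>carrier := cocycles k X\<rparr>) (coboundaries k X)"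

section \<open>Toric varieties\<close>

text \<open>
  The space of complex points, in the classical topology, of the toric variety of a fan in
  \<open>span N\<close>, where \<open>N\<close> is a lattice in a Euclidean space, not necessarily of full rank.  The
  dual of \<open>span N\<close> is identified with \<open>span N\<close> by the inner product.
\<close>

definition char_lattice :: "'a::euclidean_space set \<Rightarrow> 'a set" where
  "char_lattice N = {m \<in> span N. \<forall>v\<in>N. m \<bullet> v \<in> \<int>}"

definition char_monoid :: "'a::euclidean_space set \<Rightarrow> 'a set \<Rightarrow> 'a set" where
  "char_monoid N \<sigma> = {m \<in> char_lattice N. \<forall>v\<in>\<sigma>. 0 \<le> m \<bullet> v}"

text \<open>
  The complex points of \<open>Spec \<complex>[S]\<close> are the monoid homomorphisms from \<open>S\<close> to the
  multiplicative monoid \<open>\<complex>\<close>; for a finitely generated monoid, pointwise convergence gives the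
  classical topology.
\<close>

definition affine_toric :: "'a::euclidean_space set \<Rightarrow> 'a set \<Rightarrow> ('a \<Rightarrow> complex) topology" where
  "affine_toric N \<sigma> =
     subtopology (product_topology (\<lambda>_. euclidean) (char_monoid N \<sigma>))
       {x. x 0 = 1 \<and> (\<forall>m\<in>char_monoid N \<sigma>. \<forall>m'\<in>char_monoid N \<sigma>. x (m + m') = x m * x m')}"

definition quotient_topology :: "'x topology \<Rightarrow> ('x \<times> 'x) set \<Rightarrow> 'x set topology" where
  "quotient_topology X r =
     topology (\<lambda>U. U \<subseteq> topspace X // r \<and> openin X {x \<in> topspace X. r `` {x} \<in> U})"

lemma istopology_quotient_topology:
  "istopology (\<lambda>U. U \<subseteq> topspace X // r \<and> openin X {x \<in> topspace X. r `` {x} \<in> U})"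
proof -
  have *: "{x \<in> topspace X. r `` {x} \<in> S \<inter> T} =
      {x \<in> topspace X. r `` {x} \<in> S} \<inter> {x \<in> topspace X. r `` {x} \<in> T}" for S T
    by auto
  have **: "{x \<in> topspace X. r `` {x} \<in> \<Union>K} = (\<Union>U\<in>K. {x \<in> topspace X. r `` {x} \<in> U})" for K
    by auto
  show ?thesis
    unfolding istopology_def * ** by (auto intro!: openin_Union)
qed

text \<open>
  Since \<open>\<sigma> \<inter> \<tau>\<close> is a common face of \<open>\<sigma>\<close> and \<open>\<tau>\<close>, restriction of homomorphisms embeds the
  chart of \<open>\<sigma> \<inter> \<tau>\<close> into the charts of \<open>\<sigma>\<close> and of \<open>\<tau>\<close>; the charts are glued along it.
\<close>

definition gluing :: "'a::euclidean_space set \<Rightarrow> 'a set set \<Rightarrow>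
    (('a set \<times> ('a \<Rightarrow> complex)) \<times> ('a set \<times> ('a \<Rightarrow> complex))) set" where
  "gluing N \<Sigma> =
     {((\<sigma>, restrict z (char_monoid N \<sigma>)), (\<tau>, restrict z (char_monoid N \<tau>))) | \<sigma> \<tau> z.
        \<sigma> \<in> \<Sigma> \<and> \<tau> \<in> \<Sigma> \<and> z \<in> topspace (affine_toric N (\<sigma> \<inter> \<tau>))}"

type_synonym 'a toric_point = "('a set \<times> ('a \<Rightarrow> complex)) set"

definition toric_variety :: "'a::euclidean_space set \<Rightarrow> 'a set set \<Rightarrow> 'a toric_point topology" where
  "toric_variety N \<Sigma> = quotient_topology (sum_topology (affine_toric N) \<Sigma>) (gluing N \<Sigma>)"

section \<open>Polytopes, fans and boxes\<close>

definition integer_lattice :: "(real ^ 'n) set" where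
  "integer_lattice = {x. \<forall>i. x $ i \<in> \<int>}"

definition lattice_polytope :: "(real ^ 'n) set \<Rightarrow> bool" where
  "lattice_polytope P \<longleftrightarrow> (\<exists>S. finite S \<and> S \<subseteq> integer_lattice \<and> P = convex hull S)"

definition simplicial_polytope :: "'a::euclidean_space set \<Rightarrow> bool" where
  "simplicial_polytope P \<longleftrightarrow> polytope P \<and> (\<forall>F. F face_of P \<and> F \<noteq> P \<longrightarrow> (\<exists>k. k simplex F))"

definition vertices :: "'a::euclidean_space set \<Rightarrow> 'a set" where
  "vertices P = {v. v extreme_point_of P}"

text \<open>The empty face contributes the cone \<open>{0}\<close>.\<close>

definition polytope_fan :: "'a::euclidean_space set \<Rightarrow> 'a set set" where
  "polytope_fan P = {convex_cone hull F | F. F face_of P \<and> F \<noteq> P}"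

definition ray_gens :: "'a::euclidean_space set \<Rightarrow> 'a set \<Rightarrow> 'a set" where
  "ray_gens P \<sigma> = {b \<in> vertices P. convex_cone hull {b} face_of \<sigma>}"

definition cone_box :: "(real ^ 'n) set \<Rightarrow> (real ^ 'n) set \<Rightarrow> (real ^ 'n) set" where
  "cone_box P \<sigma> = {v \<in> integer_lattice.
     \<exists>q. (\<forall>b\<in>ray_gens P \<sigma>. 0 < q b \<and> q b < 1) \<and> v = (\<Sum>b\<in>ray_gens P \<sigma>. q b *\<^sub>R b)}"

definition sector_labels :: "(real ^ 'n) set \<Rightarrow> (real ^ 'n) set" where
  "sector_labels P = (\<Union>\<sigma>\<in>polytope_fan P. cone_box P \<sigma>)"

definition min_cone :: "'a::euclidean_space set \<Rightarrow> 'a \<Rightarrow> 'a set" where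
  "min_cone P l = (LEAST \<sigma>. \<sigma> \<in> polytope_fan P \<and> l \<in> \<sigma>)"

text \<open>The coefficients of \<open>l = \<Sum> q\<^sub>b b\<close>; the generators of a cone over a simplex are independent.\<close>

definition box_coeff :: "'a::euclidean_space set \<Rightarrow> 'a \<Rightarrow> 'a \<Rightarrow> real" where
  "box_coeff P l = representation (ray_gens P (min_cone P l)) l"

definition age :: "'a::euclidean_space set \<Rightarrow> 'a \<Rightarrow> real" where
  "age P l = (\<Sum>b\<in>ray_gens P (min_cone P l). box_coeff P l b)"

definition inverse_label :: "'a::euclidean_space set \<Rightarrow> 'a \<Rightarrow> 'a" where
  "inverse_label P l = (\<Sum>b\<in>ray_gens P (min_cone P l). (1 - box_coeff P l b) *\<^sub>R b)"

section \<open>Sectors and orbifold cohomology\<close>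

text \<open>
  The quotient of the ambient space by the span of \<open>\<sigma>\<close> is realised as the orthogonal complement
  of \<open>\<sigma>\<close>, and the quotient map as the orthogonal projection.  The lattice of the quotient fan is
  thus the projected lattice, which in general is not contained in \<^const>\<open>integer_lattice\<close>.
\<close>

definition quotient_proj :: "'a::euclidean_space set \<Rightarrow> 'a \<Rightarrow> 'a" where
  "quotient_proj \<sigma> v = (THE w. w \<in> \<sigma>\<^sup>\<bottom> \<and> v - w \<in> span \<sigma>)"

definition quotient_fan :: "'a::euclidean_space set set \<Rightarrow> 'a set \<Rightarrow> 'a set set" where
  "quotient_fan \<Sigma> \<sigma> = {quotient_proj \<sigma> ` \<tau> | \<tau>. \<tau> \<in> \<Sigma> \<and> \<sigma> face_of \<tau>}"

definition sector :: "(real ^ 'n) set \<Rightarrow> real ^ 'n \<Rightarrow> (real ^ 'n) toric_point topology" where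
  "sector P l = toric_variety (quotient_proj (min_cone P l) ` integer_lattice)
                  (quotient_fan (polytope_fan P) (min_cone P l))"

definition sector_dim :: "(real ^ 'n) set \<Rightarrow> real ^ 'n \<Rightarrow> nat" where
  "sector_dim P l = CARD('n) - dim (min_cone P l)"

text \<open>
  The index \<open>(l, j)\<close> stands for \<open>H\<^sup>2\<^sup>j\<close> of the sector of \<open>l\<close>, which is a summand of orbifold
  cohomology in degree \<open>2 (j + age P l)\<close>.  All rational degrees are summed here.
\<close>

type_synonym 'n orb_class =
  "(real ^ 'n) \<times> nat \<Rightarrow> (real ^ 'n) toric_point cochain set"

definition orb_index :: "(real ^ 'n) set \<Rightarrow> ((real ^ 'n) \<times> nat) set" where
  "orb_index P = sector_labels P \<times> UNIV"

definition orb_summand :: "(real ^ 'n) set \<Rightarrow> (real ^ 'n) \<times> nat \<Rightarrow>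
    (complex, (real ^ 'n) toric_point cochain set) module" where
  "orb_summand P = (\<lambda>(l, j). cohomology (2 * j) (sector P l))"

definition orb_cohomology :: "(real ^ 'n) set \<Rightarrow> (complex, 'n orb_class) module" where
  "orb_cohomology P = direct_sum_module (orb_index P) (orb_summand P)"

definition orb_part :: "(real ^ 'n) set \<Rightarrow> ((real ^ 'n) \<times> nat) set \<Rightarrow> 'n orb_class set" where
  "orb_part P J = partial_sum (orb_index P) (orb_summand P) J"

section \<open>The mixed Hodge structure\<close>

definition hodge_degrees :: "(real ^ 'n) set \<Rightarrow> int \<Rightarrow> real ^ 'n \<Rightarrow> nat set" where
  "hodge_degrees P p l =
     (if age P l \<in> \<int>
      then {j. \<exists>i\<ge>p. real j = real CARD('n) - of_int i - age P l}
      else {j. \<exists>i\<ge>p. int j = int CARD('n) - 1 - i - \<lfloor>age P l\<rfloor>})"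

definition weight_degrees :: "(real ^ 'n) set \<Rightarrow> int \<Rightarrow> real ^ 'n \<Rightarrow> nat set" where
  "weight_degrees P m l =
     (if age P l \<in> \<int>
      then {j. int CARD('n) + int (sector_dim P l) - m \<le> 2 * int j}
      else {j. int CARD('n) - 1 + int (sector_dim P l) - m \<le> 2 * int j})"

definition orb_hodge_filtration :: "(real ^ 'n) set \<Rightarrow> int \<Rightarrow> 'n orb_class set" where
  "orb_hodge_filtration P p = orb_part P {(l, j). j \<in> hodge_degrees P p l}"

definition orb_weight_filtration :: "(real ^ 'n) set \<Rightarrow> int \<Rightarrow> 'n orb_class set" where
  "orb_weight_filtration P m = orb_part P {(l, j). j \<in> weight_degrees P m l}"

definition antilinear_involution :: "(complex, 'v) module \<Rightarrow> ('v \<Rightarrow> 'v) \<Rightarrow> bool" where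
  "antilinear_involution V \<kappa> \<longleftrightarrow>
     (\<forall>x\<in>carrier V. \<kappa> x \<in> carrier V \<and> \<kappa> (\<kappa> x) = x) \<and>
     (\<forall>x\<in>carrier V. \<forall>y\<in>carrier V. \<kappa> (x \<oplus>\<^bsub>V\<^esub> y) = \<kappa> x \<oplus>\<^bsub>V\<^esub> \<kappa> y) \<and>
     (\<forall>c. \<forall>x\<in>carrier V. \<kappa> (c \<odot>\<^bsub>V\<^esub> x) = cnj c \<odot>\<^bsub>V\<^esub> \<kappa> x)"

definition poincare_lefschetz_conjugation ::
  "(real ^ 'n) set \<Rightarrow> ('n orb_class \<Rightarrow> 'n orb_class) \<Rightarrow> bool" where
  "poincare_lefschetz_conjugation P \<kappa> \<longleftrightarrow>
     antilinear_involution (orb_cohomology P) \<kappa> \<and>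
     (\<forall>l\<in>sector_labels P. \<forall>i.
        \<kappa> ` orb_part P {(l, i)} \<subseteq> orb_part P ({inverse_label P l} \<times> {i..}))"

text \<open>The data of a mixed Hodge structure, without the axioms.\<close>

record 'v mhs =
  space :: "(complex, 'v) module"
  real_form :: "'v set"
  hodge_filtration :: "int \<Rightarrow> 'v set"
  weight_filtration :: "int \<Rightarrow> 'v set"

definition MHS_orb :: "(real ^ 'n) set \<Rightarrow> ('n orb_class \<Rightarrow> 'n orb_class) \<Rightarrow> ('n orb_class) mhs" where
  "MHS_orb P \<kappa> =
     \<lparr>space = orb_cohomology P,
      real_form = {x \<in> carrier (orb_cohomology P). \<kappa> x = x},
      hodge_filtration = orb_hodge_filtration P,
      weight_filtration = orb_weight_filtration P\<rparr>"

definition gr_weight :: "'v mhs \<Rightarrow> int \<Rightarrow> (complex, 'v set) module" where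
  "gr_weight M m =
     quotient_module ((space M)\<lparr>carrier := weight_filtration M m\<rparr>) (weight_filtration M (m - 1))"

text \<open>The filtration induced on the graded quotient: the image of \<open>F\<^sup>p \<inter> W\<^sub>m\<close>.\<close>

definition hodge_filtration_gr :: "'v mhs \<Rightarrow> int \<Rightarrow> int \<Rightarrow> 'v set set" where
  "hodge_filtration_gr M m p =
     (\<lambda>x. weight_filtration M (m - 1) +>\<^bsub>space M\<^esub> x) `
       (hodge_filtration M p \<inter> weight_filtration M m)"

definition gr_hodge_weight :: "'v mhs \<Rightarrow> int \<Rightarrow> int \<Rightarrow> (complex, 'v set set) module" where
  "gr_hodge_weight M p m =
     quotient_module ((gr_weight M m)\<lparr>carrier := hodge_filtration_gr M m p\<rparr>)
       (hodge_filtration_gr M m (p + 1))"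

definition hodge_number :: "'v mhs \<Rightarrow> int \<Rightarrow> int \<Rightarrow> enat" where
  "hodge_number M p q = vdim (gr_hodge_weight M p (p + q))"

definition hodge_tate :: "'v mhs \<Rightarrow> bool" where
  "hodge_tate M \<longleftrightarrow> (\<forall>p q. p \<noteq> q \<longrightarrow> hodge_number M p q = 0)"

end

theory Submission
  imports Defs
begin

text \<open>
  Both filtrations on orbifold cohomology are sums of the groups \<open>H\<^sup>2\<^sup>j(X\<^sub>l)\<close>, so each of these groups sits
  in a single bidegree \<open>(p, q)\<close>, and \<open>gr\<^sub>F\<^sup>p gr\<^sup>W\<^sub>p\<^sub>+\<^sub>q\<close> is the sum of the groups of bidegree \<open>(p, q)\<close>.
  The structure is therefore of Hodge--Tate type if and only if every nonzero \<open>H\<^sup>2\<^sup>j(X\<^sub>l)\<close> has \<open>p = q\<close>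
  (\<open>hodge_tate_split_iff\<close>).

  Write \<open>i\<^sub>l\<close> for the age and \<open>l'\<close> for the inverse label.  For integral age,
  \<open>p = n - j - i\<^sub>l\<close> and \<open>p + q = n + n\<^sub>l - 2 j\<close>; for nonintegral age, \<open>p = n - 1 - j - \<lfloor>i\<^sub>l\<rfloor>\<close> and
  \<open>p + q = n - 1 + n\<^sub>l - 2 j\<close>.  In both cases the relation \<open>n\<^sub>l + i\<^sub>l + i\<^sub>l\<^sub>' = n\<close> turns the difference
  into \<open>p - q = \<lfloor>i\<^sub>l\<^sub>'\<rfloor> - \<lfloor>i\<^sub>l\<rfloor>\<close>, whatever \<open>j\<close> is (\<open>bidegree_difference\<close>).  Hence equality of the integer
  parts is sufficient.  It is also necessary, because \<open>H\<^sup>0(X\<^sub>l)\<close> is never zero: a toric variety contains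
  the unit of its torus, and \<open>H\<^sup>0\<close> of a nonempty space contains the constant functions
  (\<open>sector_nonempty\<close>, \<open>cohomology_0_nontrivial\<close>).

  The relation between dimension and ages (\<open>age_add_age_inverse\<close>) is convex geometry.  The vertices of a
  proper face of a simplicial polytope around \<open>0\<close> are linearly independent and are exactly the ray
  generators of the cone over the face.  The minimal cone of a positive combination of them is that
  cone, so for \<open>l\<close> and \<open>l'\<close> it is the same cone, and the coefficients \<open>q\<^sub>b\<close> and \<open>1 - q\<^sub>b\<close> add up to
  its dimension.
\<close>

section \<open>Subquotients of abelian groups\<close>

lemma additive_subgroupI_left_negation:
  assumes "abelian_group G" and "H \<subseteq> carrier G" and "\<zero>\<^bsub>G\<^esub> \<in> H"
    and "\<And>x y. x \<in> H \<Longrightarrow> y \<in> H \<Longrightarrow> x \<oplus>\<^bsub>G\<^esub> y \<in> H"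
    and "\<And>x. x \<in> H \<Longrightarrow> \<exists>y\<in>H. y \<oplus>\<^bsub>G\<^esub> x = \<zero>\<^bsub>G\<^esub>"
  shows "additive_subgroup H G"
proof (intro additive_subgroupI)
  interpret abelian_group G by fact
  show "subgroup H (add_monoid G)"
  proof (rule subgroup.intro)
    fix x assume x: "x \<in> H"
    then obtain y where y: "y \<in> H" "y \<oplus>\<^bsub>G\<^esub> x = \<zero>\<^bsub>G\<^esub>"
      using assms(5) by blast
    then have "\<ominus>\<^bsub>G\<^esub> x = y"
      using x assms(2) by (intro minus_equality) auto
    then show "inv\<^bsub>add_monoid G\<^esub> x \<in> H"
      using y by (simp add: a_inv_def)
  qed (use assms in auto)
qed

text \<open>
  Cosets and their sums are computed in the group operation alone, so replacing the carrier of
  \<open>G\<close> by \<open>Z\<close> only selects cosets: the subquotient is the image of \<open>Z\<close> in \<open>G / U\<close>.  All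
  quotients here, from cohomology to the bigraded pieces, have this shape.
\<close>

lemma quotient_module_sel [simp]:
  "carrier (quotient_module (G\<lparr>carrier := Z\<rparr>) U) = (\<lambda>x. U +>\<^bsub>G\<^esub> x) ` Z"
  "add (quotient_module (G\<lparr>carrier := Z\<rparr>) U) = set_add G"
  "zero (quotient_module (G\<lparr>carrier := Z\<rparr>) U) = U"
  by (auto simp: quotient_module_def A_RCOSETS_def RCOSETS_def a_r_coset_def r_coset_def
      set_add_def set_mult_def fun_eq_iff)

lemma abelian_group_subquotient:
  assumes G: "abelian_group G" and U: "additive_subgroup U G" and Z: "additive_subgroup Z G"
  shows "abelian_group (quotient_module (G\<lparr>carrier := Z\<rparr>) U)"
proof -
  interpret U: abelian_subgroup U G
    using U G by (rule abelian_subgroupI3)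
  interpret Z: additive_subgroup Z G by fact
  have sum: "set_add G (U +>\<^bsub>G\<^esub> x) (U +>\<^bsub>G\<^esub> y) = U +>\<^bsub>G\<^esub> (x \<oplus>\<^bsub>G\<^esub> y)" if "x \<in> Z" "y \<in> Z" for x y
    using that by (simp add: U.a_rcos_sum)
  have zero: "U +>\<^bsub>G\<^esub> \<zero>\<^bsub>G\<^esub> = U"
    by (simp add: U.a_subset)
  show ?thesis
  proof (rule abelian_groupI, goal_cases)
    case 2
    show ?case using zero Z.zero_closed by (auto intro!: image_eqI[of _ _ "\<zero>\<^bsub>G\<^esub>"])
  next
    case (5 X)
    then show ?case using U.rcosets_add_eq U.a_rcosetsI[OF U.a_subset] by auto
  next
    case (6 X)
    then obtain x where x: "x \<in> Z" "X = U +>\<^bsub>G\<^esub> x" by auto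
    then have "set_add G (U +>\<^bsub>G\<^esub> (\<ominus>\<^bsub>G\<^esub> x)) X = U"
      using sum zero by (simp add: U.l_neg)
    then show ?case using x by auto
  next
    case (4 X Y)
    then obtain x y where "x \<in> Z" "y \<in> Z" "X = U +>\<^bsub>G\<^esub> x" "Y = U +>\<^bsub>G\<^esub> y" by auto
    then show ?case by (simp add: sum U.a_comm)
  qed (auto simp: sum U.a_assoc)
qed

text \<open>
  The filtration that \<open>F\<close> induces on a weight quotient consists of such images, and the second
  quotient is taken by them.
\<close>

lemma additive_subgroup_subquotient:
  assumes G: "abelian_group G" and U: "additive_subgroup U G" and Z: "additive_subgroup Z G"
    and A: "additive_subgroup A G" "A \<subseteq> Z"
  shows "additive_subgroup ((\<lambda>x. U +>\<^bsub>G\<^esub> x) ` A) (quotient_module (G\<lparr>carrier := Z\<rparr>) U)"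
proof (rule additive_subgroupI_left_negation)
  interpret U: abelian_subgroup U G
    using U G by (rule abelian_subgroupI3)
  interpret A: additive_subgroup A G by fact
  have zero: "U +>\<^bsub>G\<^esub> \<zero>\<^bsub>G\<^esub> = U"
    by (simp add: U.a_subset)
  then show "\<zero>\<^bsub>quotient_module (G\<lparr>carrier := Z\<rparr>) U\<^esub> \<in> (\<lambda>x. U +>\<^bsub>G\<^esub> x) ` A"
    using A.zero_closed by (auto intro!: image_eqI[of _ _ "\<zero>\<^bsub>G\<^esub>"])
  fix X assume "X \<in> (\<lambda>x. U +>\<^bsub>G\<^esub> x) ` A"
  then obtain x where x: "x \<in> A" "X = U +>\<^bsub>G\<^esub> x" by auto
  then have "set_add G (U +>\<^bsub>G\<^esub> (\<ominus>\<^bsub>G\<^esub> x)) X = U"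
    using zero by (simp add: U.a_rcos_sum U.l_neg)
  then show "\<exists>Y\<in>(\<lambda>x. U +>\<^bsub>G\<^esub> x) ` A.
      Y \<oplus>\<^bsub>quotient_module (G\<lparr>carrier := Z\<rparr>) U\<^esub> X = \<zero>\<^bsub>quotient_module (G\<lparr>carrier := Z\<rparr>) U\<^esub>"
    using x by auto
next
  interpret U: abelian_subgroup U G
    using U G by (rule abelian_subgroupI3)
  interpret A: additive_subgroup A G by fact
  fix X Y assume "X \<in> (\<lambda>x. U +>\<^bsub>G\<^esub> x) ` A" "Y \<in> (\<lambda>x. U +>\<^bsub>G\<^esub> x) ` A"
  then show "X \<oplus>\<^bsub>quotient_module (G\<lparr>carrier := Z\<rparr>) U\<^esub> Y \<in> (\<lambda>x. U +>\<^bsub>G\<^esub> x) ` A"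
    by (auto simp: U.a_rcos_sum)
qed (use A abelian_group_subquotient[OF G U Z] in auto)

lemma a_r_coset_eq_self_iff:
  assumes "abelian_group G" and "additive_subgroup U G" and "x \<in> carrier G"
  shows "U +>\<^bsub>G\<^esub> x = U \<longleftrightarrow> x \<in> U"
proof -
  interpret abelian_group G by fact
  interpret U: additive_subgroup U G by fact
  show ?thesis
    using a_coset_join1[OF _ assms(3) U.a_subgroup] a_coset_join2[OF assms(3) U.a_subgroup] by auto
qed

text \<open>
  Only an empty basis has cardinality \<open>0\<close>, and the empty sum is the zero vector.  If \<open>0\<close> were
  not in the carrier, the empty sum would be an arbitrary value.
\<close>

lemma vdim_eq_0_iff:
  assumes "\<zero>\<^bsub>V\<^esub> \<in> carrier V"
  shows "vdim V = 0 \<longleftrightarrow> carrier V = {\<zero>\<^bsub>V\<^esub>}"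
proof -
  have basis: "finite_basis V {} \<longleftrightarrow> carrier V = {\<zero>\<^bsub>V\<^esub>}"
    using assms by (auto simp: finite_basis_def finsum_def finprod_def)
  have "vdim V = 0 \<longleftrightarrow> finite_basis V {}"
  proof
    assume V: "vdim V = 0"
    then have "{B. finite_basis V B} \<noteq> {}"
      by (auto simp: vdim_def Inf_enat_def simp del: Collect_empty_eq)
    then have "vdim V \<in> (\<lambda>B. enat (card B)) ` {B. finite_basis V B}"
      unfolding vdim_def Inf_enat_def by (auto intro: LeastI)
    then show "finite_basis V {}"
      using V by (auto simp: finite_basis_def zero_enat_def)
  next
    assume "finite_basis V {}"
    then have "vdim V \<le> enat (card ({} :: 'a set))"
      unfolding vdim_def by (intro INF_lower) auto
    then show "vdim V = 0" by (simp add: zero_enat_def[symmetric])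
  qed
  with basis show ?thesis by simp
qed

lemma vdim_subquotient_eq_0_iff:
  assumes "abelian_group G" and "additive_subgroup U G" and "additive_subgroup Z G"
  shows "vdim (quotient_module (G\<lparr>carrier := Z\<rparr>) U) = 0 \<longleftrightarrow> Z \<subseteq> U"
proof -
  interpret Q: abelian_group "quotient_module (G\<lparr>carrier := Z\<rparr>) U"
    using assms by (rule abelian_group_subquotient)
  interpret Z: additive_subgroup Z G by fact
  have "vdim (quotient_module (G\<lparr>carrier := Z\<rparr>) U) = 0 \<longleftrightarrow> (\<lambda>x. U +>\<^bsub>G\<^esub> x) ` Z = {U}"
    using vdim_eq_0_iff[OF Q.zero_closed] by simp
  also have "\<dots> \<longleftrightarrow> Z \<subseteq> U"
  proof -
    have "U +>\<^bsub>G\<^esub> x = U \<longleftrightarrow> x \<in> U" if "x \<in> Z" for x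
      using a_r_coset_eq_self_iff[OF assms(1,2)] Z.a_subset that by blast
    then have "(\<forall>x\<in>Z. U +>\<^bsub>G\<^esub> x = U) \<longleftrightarrow> Z \<subseteq> U" by blast
    moreover have "f ` Z = {U} \<longleftrightarrow> (\<forall>x\<in>Z. f x = U)" for f
      using Z.zero_closed by blast
    ultimately show ?thesis by simp
  qed
  finally show ?thesis .
qed

section \<open>Direct sums split by two gradings\<close>

lemma direct_sum_module_sel [simp]:
  "carrier (direct_sum_module I V) =
     {x \<in> \<Pi>\<^sub>E i\<in>I. carrier (V i). finite {i \<in> I. x i \<noteq> \<zero>\<^bsub>V i\<^esub>}}"
  "add (direct_sum_module I V) x y = (\<lambda>i\<in>I. x i \<oplus>\<^bsub>V i\<^esub> y i)"
  "zero (direct_sum_module I V) = (\<lambda>i\<in>I. \<zero>\<^bsub>V i\<^esub>)"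
  by (simp_all add: direct_sum_module_def)

text \<open>
  The group laws with the group as an explicit parameter, for rewriting simultaneously in all the
  summands of a family.
\<close>

lemma abelian_group_laws:
  assumes "abelian_group G"
  shows "\<zero>\<^bsub>G\<^esub> \<in> carrier G"
    and "x \<in> carrier G \<Longrightarrow> y \<in> carrier G \<Longrightarrow> x \<oplus>\<^bsub>G\<^esub> y \<in> carrier G"
    and "x \<in> carrier G \<Longrightarrow> \<zero>\<^bsub>G\<^esub> \<oplus>\<^bsub>G\<^esub> x = x"
    and "x \<in> carrier G \<Longrightarrow> x \<oplus>\<^bsub>G\<^esub> \<zero>\<^bsub>G\<^esub> = x"
    and "x \<in> carrier G \<Longrightarrow> y \<in> carrier G \<Longrightarrow> x \<oplus>\<^bsub>G\<^esub> y = y \<oplus>\<^bsub>G\<^esub> x"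
    and "x \<in> carrier G \<Longrightarrow> y \<in> carrier G \<Longrightarrow> z \<in> carrier G \<Longrightarrow>
      x \<oplus>\<^bsub>G\<^esub> y \<oplus>\<^bsub>G\<^esub> z = x \<oplus>\<^bsub>G\<^esub> (y \<oplus>\<^bsub>G\<^esub> z)"
    and "x \<in> carrier G \<Longrightarrow> \<ominus>\<^bsub>G\<^esub> x \<in> carrier G"
    and "x \<in> carrier G \<Longrightarrow> \<ominus>\<^bsub>G\<^esub> x \<oplus>\<^bsub>G\<^esub> x = \<zero>\<^bsub>G\<^esub>"
    and "\<ominus>\<^bsub>G\<^esub> \<zero>\<^bsub>G\<^esub> = \<zero>\<^bsub>G\<^esub>"
proof -
  interpret abelian_group G by fact
  show "\<zero>\<^bsub>G\<^esub> \<in> carrier G"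
    and "x \<in> carrier G \<Longrightarrow> y \<in> carrier G \<Longrightarrow> x \<oplus>\<^bsub>G\<^esub> y \<in> carrier G"
    and "x \<in> carrier G \<Longrightarrow> \<zero>\<^bsub>G\<^esub> \<oplus>\<^bsub>G\<^esub> x = x"
    and "x \<in> carrier G \<Longrightarrow> x \<oplus>\<^bsub>G\<^esub> \<zero>\<^bsub>G\<^esub> = x"
    and "x \<in> carrier G \<Longrightarrow> y \<in> carrier G \<Longrightarrow> x \<oplus>\<^bsub>G\<^esub> y = y \<oplus>\<^bsub>G\<^esub> x"
    and "x \<in> carrier G \<Longrightarrow> y \<in> carrier G \<Longrightarrow> z \<in> carrier G \<Longrightarrow>
      x \<oplus>\<^bsub>G\<^esub> y \<oplus>\<^bsub>G\<^esub> z = x \<oplus>\<^bsub>G\<^esub> (y \<oplus>\<^bsub>G\<^esub> z)"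
    and "x \<in> carrier G \<Longrightarrow> \<ominus>\<^bsub>G\<^esub> x \<in> carrier G"
    and "x \<in> carrier G \<Longrightarrow> \<ominus>\<^bsub>G\<^esub> x \<oplus>\<^bsub>G\<^esub> x = \<zero>\<^bsub>G\<^esub>"
    and "\<ominus>\<^bsub>G\<^esub> \<zero>\<^bsub>G\<^esub> = \<zero>\<^bsub>G\<^esub>"
    by (auto simp: a_assoc l_neg intro: a_comm)
qed

lemma abelian_group_direct_sum:
  assumes V: "\<And>i. i \<in> I \<Longrightarrow> abelian_group (V i)"
  shows "abelian_group (direct_sum_module I V)"
proof (rule abelian_groupI, goal_cases)
  note laws = abelian_group_laws[OF V]
  case (1 x y)
  have "{i \<in> I. x i \<oplus>\<^bsub>V i\<^esub> y i \<noteq> \<zero>\<^bsub>V i\<^esub>} \<subseteq> {i \<in> I. x i \<noteq> \<zero>\<^bsub>V i\<^esub>} \<union> {i \<in> I. y i \<noteq> \<zero>\<^bsub>V i\<^esub>}"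
    by (auto simp: laws)
  then have "finite {i \<in> I. x i \<oplus>\<^bsub>V i\<^esub> y i \<noteq> \<zero>\<^bsub>V i\<^esub>}"
    using 1 by (auto intro: finite_subset)
  with 1 show ?case
    by (auto simp: PiE_iff laws cong: conj_cong)
next
  note laws = abelian_group_laws[OF V]
  case 2
  then show ?case by (auto simp: laws cong: conj_cong)
next
  note laws = abelian_group_laws[OF V]
  case (3 x y z)
  then show ?case by (auto simp: fun_eq_iff PiE_iff laws(6))
next
  note laws = abelian_group_laws[OF V]
  case (4 x y)
  then show ?case by (auto simp: fun_eq_iff PiE_iff intro!: laws(5))
next
  note laws = abelian_group_laws[OF V]
  case (5 x)
  then show ?case by (auto simp: restrict_def fun_eq_iff PiE_iff extensional_def laws)
next
  note laws = abelian_group_laws[OF V]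
  case (6 x)
  let ?y = "\<lambda>i\<in>I. \<ominus>\<^bsub>V i\<^esub> x i"
  have "{i \<in> I. ?y i \<noteq> \<zero>\<^bsub>V i\<^esub>} \<subseteq> {i \<in> I. x i \<noteq> \<zero>\<^bsub>V i\<^esub>}"
    by (auto simp: laws)
  moreover have "finite {i \<in> I. x i \<noteq> \<zero>\<^bsub>V i\<^esub>}"
    using 6 by simp
  ultimately have "finite {i \<in> I. ?y i \<noteq> \<zero>\<^bsub>V i\<^esub>}"
    by (rule finite_subset)
  then have "?y \<in> carrier (direct_sum_module I V)"
    using 6 by (auto simp: PiE_iff laws)
  moreover have "?y \<oplus>\<^bsub>direct_sum_module I V\<^esub> x = \<zero>\<^bsub>direct_sum_module I V\<^esub>"
    using 6 by (auto simp: fun_eq_iff PiE_iff laws(8))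
  ultimately show ?case by blast
qed

lemma additive_subgroup_partial_sum:
  assumes V: "\<And>i. i \<in> I \<Longrightarrow> abelian_group (V i)"
  shows "additive_subgroup (partial_sum I V J) (direct_sum_module I V)"
proof (rule additive_subgroupI_left_negation)
  interpret D: abelian_group "direct_sum_module I V"
    using V by (rule abelian_group_direct_sum)
  show "abelian_group (direct_sum_module I V)" ..
  show "\<zero>\<^bsub>direct_sum_module I V\<^esub> \<in> partial_sum I V J"
    using D.zero_closed by (auto simp: partial_sum_def)
  fix x assume x: "x \<in> partial_sum I V J"
  show "\<exists>y\<in>partial_sum I V J. y \<oplus>\<^bsub>direct_sum_module I V\<^esub> x = \<zero>\<^bsub>direct_sum_module I V\<^esub>"
  proof
    let ?y = "\<ominus>\<^bsub>direct_sum_module I V\<^esub> x"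
    have y: "?y \<in> carrier (direct_sum_module I V)"
      using x D.a_inv_closed unfolding partial_sum_def by blast
    have sum: "?y \<oplus>\<^bsub>direct_sum_module I V\<^esub> x = \<zero>\<^bsub>direct_sum_module I V\<^esub>"
      using x D.l_neg unfolding partial_sum_def by blast
    have "?y i = \<zero>\<^bsub>V i\<^esub>" if "i \<in> I - J" for i
    proof -
      have "(?y \<oplus>\<^bsub>direct_sum_module I V\<^esub> x) i = \<zero>\<^bsub>V i\<^esub>"
        using that by (subst sum) simp
      moreover have "?y i \<in> carrier (V i)" "x i = \<zero>\<^bsub>V i\<^esub>"
        using y x that by (auto simp: partial_sum_def)
      ultimately show ?thesis
        using that by (simp add: abelian_group_laws[OF V])
    qed
    with y show "?y \<in> partial_sum I V J" unfolding partial_sum_def by blast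
    show "?y \<oplus>\<^bsub>direct_sum_module I V\<^esub> x = \<zero>\<^bsub>direct_sum_module I V\<^esub>" by fact
  qed
  fix y assume y: "y \<in> partial_sum I V J"
  have "x \<oplus>\<^bsub>direct_sum_module I V\<^esub> y \<in> carrier (direct_sum_module I V)"
    using x y D.a_closed unfolding partial_sum_def by blast
  then show "x \<oplus>\<^bsub>direct_sum_module I V\<^esub> y \<in> partial_sum I V J"
    using x y by (auto simp: partial_sum_def abelian_group_laws[OF V])
qed (auto simp: partial_sum_def)

lemma partial_sum_Int: "partial_sum I V J \<inter> partial_sum I V K = partial_sum I V (J \<inter> K)"
  by (auto simp: partial_sum_def)

lemma partial_sum_mono: "J \<subseteq> K \<Longrightarrow> partial_sum I V J \<subseteq> partial_sum I V K"
  by (auto simp: partial_sum_def)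

text \<open>
  When both filtrations are sums of the same family of summands, each summand lies in exactly one
  bidegree, and \<open>gr\<^sub>F\<^sup>p gr\<^sup>W\<^sub>p\<^sub>+\<^sub>q\<close> is the sum of those of Hodge level \<open>p\<close> and weight \<open>p + q\<close>.  Its
  vanishing means \<open>F\<^sup>p \<inter> W\<^sub>m \<subseteq> W\<^sub>m\<^sub>-\<^sub>1 + (F\<^sup>p\<^sup>+\<^sup>1 \<inter> W\<^sub>m)\<close> for \<open>m = p + q\<close>, which is tested on vectors
  concentrated in one summand and proved by cutting a vector along the weight.
\<close>

lemma hodge_number_split_eq_0_iff:
  fixes M :: "('i \<Rightarrow> 'v) mhs" and hd wt :: "'i \<Rightarrow> int"
  assumes V: "\<And>i. i \<in> I \<Longrightarrow> abelian_group (V i)"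
    and M: "space M = direct_sum_module I V"
    and F: "\<And>p. hodge_filtration M p = partial_sum I V {i. p \<le> hd i}"
    and W: "\<And>m. weight_filtration M m = partial_sum I V {i. wt i \<le> m}"
  shows "hodge_number M p q = 0 \<longleftrightarrow>
    (\<forall>i\<in>I. hd i = p \<and> wt i = p + q \<longrightarrow> carrier (V i) \<subseteq> {\<zero>\<^bsub>V i\<^esub>})"
proof -
  note laws = abelian_group_laws[OF V]
  define m where "m = p + q"
  define D where "D = direct_sum_module I V"
  define FW where "FW = (\<lambda>p. partial_sum I V {i. p \<le> hd i \<and> wt i \<le> m})"
  define U where "U = partial_sum I V {i. wt i \<le> m - 1}"
  define Z where "Z = partial_sum I V {i. wt i \<le> m}"
  define gr where "gr = quotient_module (D\<lparr>carrier := Z\<rparr>) U"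
  have D: "abelian_group D" unfolding D_def using V by (rule abelian_group_direct_sum)
  note sub = additive_subgroup_partial_sum[of I V, OF V, folded D_def]
  interpret U: abelian_subgroup U D
    unfolding U_def using sub D by (rule abelian_subgroupI3)
  have gr: "gr_weight M m = gr" "hodge_filtration_gr M m r = (\<lambda>x. U +>\<^bsub>D\<^esub> x) ` FW r" for r
    unfolding gr_weight_def hodge_filtration_gr_def M F W FW_def U_def Z_def gr_def D_def partial_sum_Int
    by (auto simp: Collect_conj_eq)
  have group_gr: "abelian_group gr"
    unfolding gr_def using D sub sub unfolding U_def Z_def by (rule abelian_group_subquotient)
  have FWZ: "FW r \<subseteq> Z" for r
    unfolding FW_def Z_def by (intro partial_sum_mono) auto
  have FWD: "FW r \<subseteq> carrier D" for r
    unfolding FW_def D_def partial_sum_def by blast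
  have sub_gr: "additive_subgroup ((\<lambda>x. U +>\<^bsub>D\<^esub> x) ` FW r) gr" for r
    using additive_subgroup_subquotient[OF D _ _ _ FWZ, of U r] sub
    unfolding gr_def U_def Z_def FW_def by blast
  have "hodge_number M p q = 0 \<longleftrightarrow> (\<lambda>x. U +>\<^bsub>D\<^esub> x) ` FW p \<subseteq> (\<lambda>x. U +>\<^bsub>D\<^esub> x) ` FW (p + 1)"
    unfolding hodge_number_def gr_hodge_weight_def m_def[symmetric] gr
    by (intro vdim_subquotient_eq_0_iff group_gr sub_gr)
  also have "\<dots> \<longleftrightarrow> (\<forall>i\<in>I. hd i = p \<and> wt i = m \<longrightarrow> carrier (V i) \<subseteq> {\<zero>\<^bsub>V i\<^esub>})"
  proof (intro iffI ballI impI subsetI)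
    fix i v
    assume incl: "(\<lambda>x. U +>\<^bsub>D\<^esub> x) ` FW p \<subseteq> (\<lambda>x. U +>\<^bsub>D\<^esub> x) ` FW (p + 1)"
      and i: "i \<in> I" "hd i = p \<and> wt i = m" and v: "v \<in> carrier (V i)"
    define x where "x = (\<lambda>j\<in>I. if j = i then v else \<zero>\<^bsub>V j\<^esub>)"
    have "finite {j \<in> I. x j \<noteq> \<zero>\<^bsub>V j\<^esub>}"
      by (rule finite_subset[of _ "{i}"]) (auto simp: x_def)
    then have x: "x \<in> FW p"
      using i v by (auto simp: FW_def partial_sum_def x_def laws)
    then obtain y where y: "y \<in> FW (p + 1)" "U +>\<^bsub>D\<^esub> x = U +>\<^bsub>D\<^esub> y" using incl by auto
    have "x \<in> U +>\<^bsub>D\<^esub> x" using x FWD U.a_rcos_self by blast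
    with y obtain u where u: "u \<in> U" "x = u \<oplus>\<^bsub>D\<^esub> y"
      by (auto simp: a_r_coset_def r_coset_def)
    have "u i = \<zero>\<^bsub>V i\<^esub>" "y i = \<zero>\<^bsub>V i\<^esub>"
      using i u y by (auto simp: U_def FW_def partial_sum_def)
    then have "x i = \<zero>\<^bsub>V i\<^esub>"
      using i u(2) by (simp add: D_def laws)
    then show "v \<in> {\<zero>\<^bsub>V i\<^esub>}" using i by (simp add: x_def)
  next
    fix X
    assume triv: "\<forall>i\<in>I. hd i = p \<and> wt i = m \<longrightarrow> carrier (V i) \<subseteq> {\<zero>\<^bsub>V i\<^esub>}"
      and "X \<in> (\<lambda>x. U +>\<^bsub>D\<^esub> x) ` FW p"
    then obtain x where x: "x \<in> FW p" "X = U +>\<^bsub>D\<^esub> x" by auto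
    \<comment> \<open>The part of weight \<open>m\<close> is \<open>y\<close>; it has no component of Hodge level \<open>p\<close> by \<open>triv\<close>.\<close>
    define y where "y = (\<lambda>i\<in>I. if wt i \<le> m - 1 then \<zero>\<^bsub>V i\<^esub> else x i)"
    define u where "u = (\<lambda>i\<in>I. if wt i \<le> m - 1 then x i else \<zero>\<^bsub>V i\<^esub>)"
    have fin: "finite {i \<in> I. x i \<noteq> \<zero>\<^bsub>V i\<^esub>}" and xV: "\<And>i. i \<in> I \<Longrightarrow> x i \<in> carrier (V i)"
      and x0: "\<And>i. i \<in> I \<Longrightarrow> \<not> (p \<le> hd i \<and> wt i \<le> m) \<Longrightarrow> x i = \<zero>\<^bsub>V i\<^esub>"
      using x by (auto simp: FW_def partial_sum_def)
    have fins: "finite {i \<in> I. y i \<noteq> \<zero>\<^bsub>V i\<^esub>}" "finite {i \<in> I. u i \<noteq> \<zero>\<^bsub>V i\<^esub>}"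
      by (rule finite_subset[OF _ fin]; auto simp: y_def u_def)+
    have "y i = \<zero>\<^bsub>V i\<^esub>" if "i \<in> I" "\<not> (p + 1 \<le> hd i \<and> wt i \<le> m)" for i
      using that x0[of i] xV[of i] triv by (cases "hd i = p \<and> wt i = m") (auto simp: y_def)
    then have y: "y \<in> FW (p + 1)"
      using fins xV by (auto simp: FW_def partial_sum_def y_def laws)
    have u: "u \<in> U"
      using fins xV by (auto simp: U_def partial_sum_def u_def laws)
    have "x j = undefined" if "j \<notin> I" for j using x that by (auto simp: FW_def partial_sum_def)
    then have "x = u \<oplus>\<^bsub>D\<^esub> y"
      using xV by (auto simp: D_def fun_eq_iff u_def y_def laws)
    then have "X = U +>\<^bsub>D\<^esub> y"
    proof -
      have yD: "y \<in> carrier D" using y FWD by blast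
      have "U +>\<^bsub>D\<^esub> (u \<oplus>\<^bsub>D\<^esub> y) = set_add D (U +>\<^bsub>D\<^esub> u) (U +>\<^bsub>D\<^esub> y)"
        using u yD by (simp add: U.a_rcos_sum)
      also have "\<dots> = U +>\<^bsub>D\<^esub> y"
        using u yD by (simp add: U.a_rcos_const U.rcosets_add_eq U.a_rcosetsI[OF U.a_subset])
      finally show ?thesis using x(2) \<open>x = u \<oplus>\<^bsub>D\<^esub> y\<close> by simp
    qed
    with y show "X \<in> (\<lambda>x. U +>\<^bsub>D\<^esub> x) ` FW (p + 1)" by blast
  qed
  finally show ?thesis by (simp add: m_def)
qed

text \<open>
  The bidegree \<open>(p, q)\<close> of a summand is \<open>(hd i, wt i - hd i)\<close>, so \<open>p = q\<close> says \<open>2 hd i = wt i\<close>.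
\<close>

lemma hodge_tate_split_iff:
  fixes M :: "('i \<Rightarrow> 'v) mhs" and hd wt :: "'i \<Rightarrow> int"
  assumes V: "\<And>i. i \<in> I \<Longrightarrow> abelian_group (V i)"
    and M: "space M = direct_sum_module I V"
    and F: "\<And>p. hodge_filtration M p = partial_sum I V {i. p \<le> hd i}"
    and W: "\<And>m. weight_filtration M m = partial_sum I V {i. wt i \<le> m}"
  shows "hodge_tate M \<longleftrightarrow>
    (\<forall>i\<in>I. 2 * hd i \<noteq> wt i \<longrightarrow> carrier (V i) \<subseteq> {\<zero>\<^bsub>V i\<^esub>})"
proof -
  have reindex: "(\<forall>p q. p \<noteq> q \<longrightarrow> (\<forall>i\<in>I. hd i = p \<and> wt i = p + q \<longrightarrow> T i)) \<longleftrightarrow>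
      (\<forall>i\<in>I. 2 * hd i \<noteq> wt i \<longrightarrow> T i)" for T
  proof (intro iffI ballI impI allI)
    fix i
    assume *: "\<forall>p q. p \<noteq> q \<longrightarrow> (\<forall>i\<in>I. hd i = p \<and> wt i = p + q \<longrightarrow> T i)"
      and i: "i \<in> I" "2 * hd i \<noteq> wt i"
    show "T i"
      using *[rule_format, of "hd i" "wt i - hd i" i] i by simp
  next
    fix p q i
    assume *: "\<forall>i\<in>I. 2 * hd i \<noteq> wt i \<longrightarrow> T i"
      and i: "p \<noteq> q" "i \<in> I" "hd i = p \<and> wt i = p + q"
    show "T i"
      using *[rule_format, of i] i by simp
  qed
  have num: "hodge_number M p q = 0 \<longleftrightarrow>
      (\<forall>i\<in>I. hd i = p \<and> wt i = p + q \<longrightarrow> carrier (V i) \<subseteq> {\<zero>\<^bsub>V i\<^esub>})" for p q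
    using V M F W by (rule hodge_number_split_eq_0_iff)
  show ?thesis
    unfolding hodge_tate_def num by (rule reindex)
qed

section \<open>Cohomology of nonempty spaces\<close>

lemma cochains_sel [simp]:
  "carrier (cochains k X) = {\<phi>. \<forall>f. \<not> singular_simplex k X f \<longrightarrow> \<phi> f = 0}"
  "\<phi> \<oplus>\<^bsub>cochains k X\<^esub> \<psi> = (\<lambda>f. \<phi> f + \<psi> f)"
  "\<zero>\<^bsub>cochains k X\<^esub> = (\<lambda>f. 0)"
  by (simp_all add: cochains_def)

lemma abelian_group_cochains: "abelian_group (cochains k X)"
proof (rule abelian_groupI, goal_cases)
  case (6 \<phi>)
  then show ?case by (intro bexI[of _ "\<lambda>f. - \<phi> f"]) auto
qed (auto simp: algebra_simps)

lemma coboundary_add: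
  "coboundary k X (\<lambda>f. \<phi> f + \<psi> f) = (\<lambda>f. coboundary k X \<phi> f + coboundary k X \<psi> f)"
  by (auto simp: coboundary_def fun_eq_iff sum.distrib algebra_simps)

lemma coboundary_minus: "coboundary k X (\<lambda>f. - \<phi> f) = (\<lambda>f. - coboundary k X \<phi> f)"
  by (auto simp: coboundary_def fun_eq_iff sum_negf algebra_simps)

lemma coboundary_zero: "coboundary k X (\<lambda>f. 0) = (\<lambda>f. 0)"
  by (auto simp: coboundary_def fun_eq_iff)

lemma additive_subgroup_cocycles: "additive_subgroup (cocycles k X) (cochains k X)"
proof (rule additive_subgroupI_left_negation[OF abelian_group_cochains])
  fix \<phi> assume "\<phi> \<in> cocycles k X"
  then show "\<exists>\<psi>\<in>cocycles k X. \<psi> \<oplus>\<^bsub>cochains k X\<^esub> \<phi> = \<zero>\<^bsub>cochains k X\<^esub>"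
    by (intro bexI[of _ "\<lambda>f. - \<phi> f"]) (auto simp: cocycles_def coboundary_minus)
qed (auto simp: cocycles_def coboundary_add coboundary_zero)

lemma coboundary_closed: "coboundary k X \<phi> \<in> carrier (cochains (Suc k) X)"
  by (simp add: coboundary_def)

lemma additive_subgroup_coboundaries: "additive_subgroup (coboundaries k X) (cochains k X)"
proof (cases k)
  case 0
  show ?thesis
    by (rule additive_subgroupI_left_negation[OF abelian_group_cochains])
      (auto simp: 0 coboundaries_def)
next
  case (Suc i)
  have cob: "coboundaries k X = coboundary i X ` carrier (cochains i X)"
    by (simp add: Suc coboundaries_def)
  show ?thesis
    unfolding cob unfolding Suc
  proof (rule additive_subgroupI_left_negation[OF abelian_group_cochains])
    show "coboundary i X ` carrier (cochains i X) \<subseteq> carrier (cochains (Suc i) X)"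
      using coboundary_closed by blast
    show "\<zero>\<^bsub>cochains (Suc i) X\<^esub> \<in> coboundary i X ` carrier (cochains i X)"
      by (rule image_eqI[of _ _ "\<lambda>f. 0"]) (simp_all add: coboundary_zero)
  next
    fix \<alpha> \<beta>
    assume "\<alpha> \<in> coboundary i X ` carrier (cochains i X)" "\<beta> \<in> coboundary i X ` carrier (cochains i X)"
    then obtain \<phi> \<psi> where "\<phi> \<in> carrier (cochains i X)" "\<psi> \<in> carrier (cochains i X)"
      "\<alpha> = coboundary i X \<phi>" "\<beta> = coboundary i X \<psi>" by blast
    then show "\<alpha> \<oplus>\<^bsub>cochains (Suc i) X\<^esub> \<beta> \<in> coboundary i X ` carrier (cochains i X)"
      by (intro image_eqI[of _ _ "\<lambda>f. \<phi> f + \<psi> f"]) (simp_all add: coboundary_add)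
  next
    fix \<alpha> assume "\<alpha> \<in> coboundary i X ` carrier (cochains i X)"
    then obtain \<phi> where \<phi>: "\<phi> \<in> carrier (cochains i X)" "\<alpha> = coboundary i X \<phi>" by blast
    show "\<exists>\<beta>\<in>coboundary i X ` carrier (cochains i X).
        \<beta> \<oplus>\<^bsub>cochains (Suc i) X\<^esub> \<alpha> = \<zero>\<^bsub>cochains (Suc i) X\<^esub>"
    proof
      show "(\<lambda>f. - \<alpha> f) \<in> coboundary i X ` carrier (cochains i X)"
        using \<phi> by (intro image_eqI[of _ _ "\<lambda>f. - \<phi> f"]) (simp_all add: coboundary_minus)
    qed simp
  qed
qed

lemma abelian_group_cohomology: "abelian_group (cohomology k X)"
  unfolding cohomology_def
  by (intro abelian_group_subquotient abelian_group_cochains additive_subgroup_coboundaries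
      additive_subgroup_cocycles)

text \<open>
  The cochain that is \<open>1\<close> on every point is a cocycle, since the two endpoints of a path cancel, and
  it is nonzero as soon as there is a point; in degree \<open>0\<close> only the zero cochain is a coboundary.
\<close>

lemma cohomology_0_nontrivial:
  assumes "topspace X \<noteq> {}"
  shows "\<not> carrier (cohomology 0 X) \<subseteq> {\<zero>\<^bsub>cohomology 0 X\<^esub>}"
proof -
  obtain a where a: "a \<in> topspace X" using assms by blast
  define \<phi> :: "'a cochain" where "\<phi> = (\<lambda>f. if singular_simplex 0 X f then 1 else 0)"
  let ?f = "\<lambda>t\<in>standard_simplex 0. a"
  have "singular_simplex 0 X ?f"
    using a by (auto simp: singular_simplex_def topspace_subtopology
        intro!: continuous_map_eq[of _ _ "\<lambda>_. a"])
  then have "\<phi> \<noteq> (\<lambda>f. 0)" by (auto simp: \<phi>_def fun_eq_iff)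
  then have "\<phi> \<notin> coboundaries 0 X" by (simp add: coboundaries_def)
  moreover have \<phi>: "\<phi> \<in> cocycles 0 X"
  proof -
    have "coboundary 0 X \<phi> f = 0" for f
      using singular_simplex_singular_face[of 1 X f]
      by (simp add: coboundary_def \<phi>_def)
    then show ?thesis by (simp add: cocycles_def \<phi>_def fun_eq_iff)
  qed
  ultimately have "coboundaries 0 X +>\<^bsub>cochains 0 X\<^esub> \<phi> \<noteq> coboundaries 0 X"
    by (subst a_r_coset_eq_self_iff[OF abelian_group_cochains additive_subgroup_coboundaries])
      (simp_all add: cocycles_def)
  then show ?thesis
    using \<phi> by (auto simp: cohomology_def)
qed

section \<open>Points of toric varieties\<close>

lemma topspace_quotient_topology: "topspace (quotient_topology X r) = topspace X // r"
proof
  have open_iff: "openin (quotient_topology X r) U \<longleftrightarrow>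
      U \<subseteq> topspace X // r \<and> openin X {x \<in> topspace X. r `` {x} \<in> U}" for U
    unfolding quotient_topology_def topology_inverse'[OF istopology_quotient_topology] ..
  show "topspace (quotient_topology X r) \<subseteq> topspace X // r"
    using open_iff openin_topspace by blast
  have "{x \<in> topspace X. r `` {x} \<in> topspace X // r} = topspace X"
    by (auto intro: quotientI)
  then show "topspace X // r \<subseteq> topspace (quotient_topology X r)"
    by (intro openin_subset) (simp add: open_iff)
qed

text \<open>
  The unit of the torus: every affine chart contains the homomorphism that is constantly \<open>1\<close>.
\<close>

lemma one_in_affine_toric:
  "(\<lambda>m\<in>char_monoid N \<sigma>. 1) \<in> topspace (affine_toric N \<sigma>)"
proof -
  have "0 \<in> char_monoid N \<sigma>"
    by (auto simp: char_monoid_def char_lattice_def span_zero)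
  moreover have "m + m' \<in> char_monoid N \<sigma>" if "m \<in> char_monoid N \<sigma>" "m' \<in> char_monoid N \<sigma>" for m m'
    using that by (auto simp: char_monoid_def char_lattice_def span_add inner_add_left)
  ultimately show ?thesis
    by (auto simp: affine_toric_def)
qed

lemma topspace_toric_variety_nonempty:
  assumes "\<Sigma> \<noteq> {}"
  shows "topspace (toric_variety N \<Sigma>) \<noteq> {}"
proof -
  have "topspace (sum_topology (affine_toric N) \<Sigma>) \<noteq> {}"
    using assms one_in_affine_toric[of N] by (fastforce simp: simp del: null_topspace_iff_trivial)
  then show ?thesis
    by (simp add: toric_variety_def topspace_quotient_topology)
qed

section \<open>The cones over the faces of a simplicial polytope\<close>

locale simplicial_polytope_around_0 =
  fixes P :: "'a::euclidean_space set"
  assumes simplicial: "simplicial_polytope P" and zero_interior: "0 \<in> interior P"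
begin

lemma convex_P: "convex P"
  using simplicial by (simp add: simplicial_polytope_def polytope_imp_convex)

lemma face_not_interior: "F face_of P \<Longrightarrow> F \<noteq> P \<Longrightarrow> z \<in> F \<Longrightarrow> z \<in> P - interior P"
  using face_of_disjoint_interior[of F P] face_of_imp_subset[of F P] by auto

lemma interior_if_scaleR_less_1:
  assumes "z \<in> P" "0 \<le> s" "s < 1"
  shows "s *\<^sub>R z \<in> interior P"
proof (cases "z = 0 \<or> s = 0")
  case False
  then have "s *\<^sub>R z \<in> open_segment 0 z"
    using assms by (auto simp: in_segment)
  then show ?thesis
    using in_interior_closure_convex_segment[OF convex_P zero_interior, of z] assms closure_subset by blast
qed (use zero_interior in auto)

text \<open>
  A ray from the interior point \<open>0\<close> leaves a convex set only once.  This is what lets statements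
  about cones be pulled back to the faces that span them.
\<close>

lemma boundary_ray_unique:
  assumes "z \<in> P - interior P" "s *\<^sub>R z \<in> P - interior P" "0 \<le> s"
  shows "s = 1"
proof (rule ccontr)
  assume "s \<noteq> 1"
  then consider "s < 1" | "s > 1" by linarith
  then show False
  proof cases
    case 1
    then show False using interior_if_scaleR_less_1 assms by auto
  next
    case 2
    then have "z = inverse s *\<^sub>R (s *\<^sub>R z)" "inverse s < 1" by (auto simp: field_simps)
    then show False using interior_if_scaleR_less_1[of "s *\<^sub>R z" "inverse s"] assms by auto
  qed
qed

text \<open>
  The vertices of a proper face are affinely independent because \<open>P\<close> is simplicial, and the affine
  hull of a proper face misses the interior point \<open>0\<close>; together this is linear independence.
\<close>

lemma
  assumes F: "F face_of P" "F \<noteq> P"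
  shows finite_vertices: "finite (vertices F)"
    and independent_vertices: "independent (vertices F)"
    and hull_vertices: "convex hull (vertices F) = F"
proof -
  obtain k where "k simplex F" using simplicial F by (auto simp: simplicial_polytope_def)
  then obtain V where V: "finite V" "\<not> affine_dependent V" "F = convex hull V"
    by (auto simp: simplex)
  then have VF: "vertices F = V"
    by (auto simp: vertices_def extreme_point_of_convex_hull_affine_independent)
  have "0 \<notin> affine hull V"
    using affine_hull_face_of_disjoint_rel_interior[OF convex_P F] zero_interior
      interior_subset_rel_interior V(3) by (auto simp: affine_hull_convex_hull)
  have "independent V"
  proof
    assume "dependent V"
    then obtain u v where u: "v \<in> V" "u v \<noteq> 0" "(\<Sum>v\<in>V. u v *\<^sub>R v) = 0"
      using V(1) by (auto simp: dependent_finite)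
    show False
    proof (cases "sum u V = 0")
      case True
      then show False using u V by (auto simp: affine_dependent_explicit_finite)
    next
      case False
      then have "sum (\<lambda>v. u v / sum u V) V = 1" by (simp add: sum_divide_distrib[symmetric])
      moreover have "(\<Sum>v\<in>V. (u v / sum u V) *\<^sub>R v) = 0"
      proof -
        have "(\<Sum>v\<in>V. (u v / sum u V) *\<^sub>R v) = inverse (sum u V) *\<^sub>R (\<Sum>v\<in>V. u v *\<^sub>R v)"
          by (simp add: scaleR_sum_right divide_inverse mult.commute)
        then show ?thesis using u by simp
      qed
      ultimately have "0 \<in> affine hull V"
        using V(1) by (auto simp: affine_hull_finite)
      then show False using \<open>0 \<notin> affine hull V\<close> by simp
    qed
  qed
  with V VF show "finite (vertices F)" "independent (vertices F)" "convex hull (vertices F) = F"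
    by auto
qed

lemma in_cone_face_iff:
  assumes "F face_of P" "x \<noteq> 0"
  shows "x \<in> convex_cone hull F \<longleftrightarrow> (\<exists>z\<in>F. \<exists>c\<ge>0. x = c *\<^sub>R z)"
  using assms hull_same[of convex F] face_of_imp_convex
  by (auto simp: convex_cone_hull_convex_hull)

lemma cone_face_coefficients:
  assumes F: "F face_of P" "F \<noteq> P" and x: "x \<in> convex_cone hull F"
  obtains c where "\<And>v. v \<in> vertices F \<Longrightarrow> 0 \<le> c v" "x = (\<Sum>v\<in>vertices F. c v *\<^sub>R v)"
proof (cases "x = 0")
  case True
  then show ?thesis by (intro that[of "\<lambda>_. 0"]) auto
next
  case False
  then obtain z t where z: "z \<in> F" "0 \<le> t" "x = t *\<^sub>R z"
    using x in_cone_face_iff F by blast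
  have "z \<in> convex hull (vertices F)" using z(1) hull_vertices[OF F] by simp
  then obtain u where "\<forall>v\<in>vertices F. 0 \<le> u v" "(\<Sum>v\<in>vertices F. u v *\<^sub>R v) = z"
    unfolding convex_hull_finite[OF finite_vertices[OF F]] by blast
  then show ?thesis
    using z by (intro that[of "\<lambda>v. t * u v"]) (auto simp: scaleR_sum_right)
qed

text \<open>
  In coordinates with respect to the independent vertices: if a convex combination of two vectors
  with nonnegative coordinates has only its \<open>b\<close>-coordinate nonzero, so have both vectors.
\<close>

lemma ray_face_of_cone:
  assumes F: "F face_of P" "F \<noteq> P" and b: "b \<in> vertices F"
  shows "convex_cone hull {b} face_of convex_cone hull F"
  unfolding face_of_def
proof (intro conjI ballI impI)
  have bF: "b \<in> F" using b by (auto simp: vertices_def extreme_point_of_def)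
  then show "convex_cone hull {b} \<subseteq> convex_cone hull F" by (intro hull_mono) auto
  show "convex (convex_cone hull {b})" by (rule convex_convex_cone_hull)
  have main: "y \<in> convex_cone hull {b}"
    if y: "y \<in> convex_cone hull F" and y': "y' \<in> convex_cone hull F" and x: "x \<in> convex_cone hull {b}"
      and seg: "x \<in> open_segment y y'" for y y' x
  proof -
    obtain c where c: "\<And>v. v \<in> vertices F \<Longrightarrow> 0 \<le> c v" "y = (\<Sum>v\<in>vertices F. c v *\<^sub>R v)"
      using cone_face_coefficients[OF F y] by metis
    obtain c' where c': "\<And>v. v \<in> vertices F \<Longrightarrow> 0 \<le> c' v" "y' = (\<Sum>v\<in>vertices F. c' v *\<^sub>R v)"
      using cone_face_coefficients[OF F y'] by metis
    obtain t where t: "x = t *\<^sub>R b"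
      using x by (auto simp: convex_cone_hull_convex_hull intro: that[of 0])
    obtain u where u: "0 < u" "u < 1" "x = (1 - u) *\<^sub>R y + u *\<^sub>R y'"
      using seg by (auto simp: in_segment)
    \<comment> \<open>the coordinates of \<open>(1 - u) y + u y' - x = 0\<close>\<close>
    define d where "d = (\<lambda>v. (1 - u) * c v + u * c' v - (if v = b then t else 0))"
    have "(\<Sum>v\<in>vertices F. (if v = b then t else 0) *\<^sub>R v) = t *\<^sub>R b"
      using b finite_vertices[OF F] by (simp add: if_distrib[of "\<lambda>a. a *\<^sub>R _"] sum.delta cong: if_cong)
    then have "(\<Sum>v\<in>vertices F. d v *\<^sub>R v) = 0"
      using t u(3) c(2) c'(2)
      by (simp add: d_def scaleR_add_left scaleR_diff_left sum.distrib sum_subtractf scaleR_sum_right)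
    then have d0: "d v = 0" if "v \<in> vertices F" for v
      using independent_vertices[OF F] finite_vertices[OF F] that by (auto simp: dependent_finite)
    have "c v = 0" if "v \<in> vertices F" "v \<noteq> b" for v
    proof -
      have "(1 - u) * c v + u * c' v = 0" "0 \<le> (1 - u) * c v" "0 \<le> u * c' v"
        using d0[OF that(1)] that c(1) c'(1) u by (auto simp: d_def)
      then have "(1 - u) * c v = 0" by linarith
      then show ?thesis using u by simp
    qed
    then have "y = (\<Sum>v\<in>{b}. c v *\<^sub>R v)"
      unfolding c(2) using b finite_vertices[OF F] by (intro sum.mono_neutral_right) auto
    then show ?thesis
      using c(1)[OF b] by (simp add: convex_cone_hull_mul hull_inc)
  qed
  fix y y' x assume *: "y \<in> convex_cone hull F" "y' \<in> convex_cone hull F"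
    "x \<in> convex_cone hull {b}" "x \<in> open_segment y y'"
  show "y \<in> convex_cone hull {b}" by (rule main[OF *])
  show "y' \<in> convex_cone hull {b}"
    by (rule main[of y' y x]) (use * in \<open>auto simp: open_segment_commute\<close>)
qed

text \<open>
  A vertex of \<open>P\<close> in the cone over \<open>F\<close> lies on the ray of a point of \<open>F\<close>; both are boundary points
  of \<open>P\<close>, hence equal.
\<close>

lemma ray_gens_cone:
  assumes F: "F face_of P" "F \<noteq> P"
  shows "ray_gens P (convex_cone hull F) = vertices F"
proof (intro equalityI subsetI)
  fix b assume "b \<in> ray_gens P (convex_cone hull F)"
  then have b: "b extreme_point_of P" "b \<in> convex_cone hull F"
    using face_of_imp_subset hull_inc[of b "{b}"] by (auto simp: ray_gens_def vertices_def)
  then have bP: "b \<in> P - interior P"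
    using extreme_point_not_in_interior by (auto simp: extreme_point_of_def)
  then have "b \<noteq> 0" using zero_interior by auto
  then obtain z c where z: "z \<in> F" "0 \<le> c" "b = c *\<^sub>R z"
    using b in_cone_face_iff[OF F(1)] by blast
  then have "c = 1"
    using boundary_ray_unique[of z c] face_not_interior[OF F] bP by blast
  with z b show "b \<in> vertices F"
    using extreme_point_of_face[OF F(1)] by (simp add: vertices_def)
next
  fix b assume "b \<in> vertices F"
  then show "b \<in> ray_gens P (convex_cone hull F)"
    using ray_face_of_cone[OF F] extreme_point_of_face[OF F(1)]
    by (auto simp: ray_gens_def vertices_def)
qed

text \<open>
  Scaled to the boundary of \<open>P\<close>, a positive combination of the vertices of \<open>F\<close> is a relative
  interior point of \<open>F\<close>.  If it also lies in the cone over \<open>G\<close>, then this boundary point is in \<open>G\<close>, and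
  a face that meets the relative interior of \<open>F\<close> contains \<open>F\<close>.
\<close>

lemma min_cone_positive_combination:
  assumes F: "F face_of P" "F \<noteq> P" and q: "\<And>b. b \<in> vertices F \<Longrightarrow> 0 < q b"
    and l: "l = (\<Sum>b\<in>vertices F. q b *\<^sub>R b)"
  shows "min_cone P l = convex_cone hull F"
proof (cases "vertices F = {}")
  case True
  then have "F = {}" using hull_vertices[OF F] by simp
  then have cone: "convex_cone hull F = {0}" by simp
  have "{0} \<in> polytope_fan P" using F cone by (auto simp: polytope_fan_def)
  then show ?thesis
    using l True unfolding min_cone_def cone by (intro Least_equality) auto
next
  case False
  define s where "s = sum q (vertices F)"
  define z where "z = inverse s *\<^sub>R l"
  have s: "s > 0"
    unfolding s_def using False q finite_vertices[OF F] by (intro sum_pos) auto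
  have "z \<in> rel_interior (convex hull vertices F)"
    by (rule subsetD[OF explicit_subset_rel_interior_convex_hull_minimal[OF finite_vertices[OF F]]])
      (use s q in \<open>auto intro!: exI[of _ "\<lambda>b. inverse s * q b"]
         simp: z_def l scaleR_sum_right sum_distrib_left[symmetric] s_def[symmetric]\<close>)
  then have z: "z \<in> rel_interior F" by (simp add: hull_vertices[OF F])
  then have zF: "z \<in> F" using rel_interior_subset by blast
  have lz: "l = s *\<^sub>R z" using s by (simp add: z_def)
  have "z \<noteq> 0" using face_not_interior[OF F zF] zero_interior by auto
  then have l0: "l \<noteq> 0" using lz s by auto
  show ?thesis unfolding min_cone_def
  proof (rule Least_equality)
    have "l \<in> convex_cone hull F"
      unfolding lz using s zF by (intro convex_cone_hull_mul hull_inc) auto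
    then show "convex_cone hull F \<in> polytope_fan P \<and> l \<in> convex_cone hull F"
      using F by (auto simp: polytope_fan_def)
    fix \<tau> assume "\<tau> \<in> polytope_fan P \<and> l \<in> \<tau>"
    then obtain G where G: "G face_of P" "G \<noteq> P" "\<tau> = convex_cone hull G" "l \<in> convex_cone hull G"
      by (auto simp: polytope_fan_def)
    then obtain w c where w: "w \<in> G" "0 \<le> c" "l = c *\<^sub>R w"
      using in_cone_face_iff[OF G(1) l0] by blast
    have zw: "z = (inverse s * c) *\<^sub>R w" by (simp add: z_def w)
    then have "inverse s * c = 1"
      using boundary_ray_unique[of w "inverse s * c"] face_not_interior[OF F zF]
        face_not_interior[OF G(1,2) w(1)] s w(2) by auto
    then have "z \<in> G" using zw w by simp
    then have "F \<subseteq> G"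
      using subset_of_face_of[OF G(1) face_of_imp_subset[OF F(1)]] z by blast
    then show "convex_cone hull F \<le> \<tau>" unfolding G(3) by (rule hull_mono)
  qed
qed

lemma box_coeff_positive_combination:
  assumes F: "F face_of P" "F \<noteq> P" and q: "\<And>b. b \<in> vertices F \<Longrightarrow> 0 < q b"
    and l: "l = (\<Sum>b\<in>vertices F. q b *\<^sub>R b)" and b: "b \<in> vertices F"
  shows "box_coeff P l b = q b"
proof -
  have "representation (vertices F) l b =
      (\<Sum>v\<in>vertices F. representation (vertices F) (q v *\<^sub>R v) b)"
    unfolding l using independent_vertices[OF F]
    by (subst representation_sum) (auto intro: span_scale span_base)
  also have "\<dots> = (\<Sum>v\<in>vertices F. if v = b then q v else 0)"
    using independent_vertices[OF F]
    by (intro sum.cong) (auto simp: representation_scale span_base representation_basis)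
  finally have "representation (vertices F) l b = q b"
    using b finite_vertices[OF F] by simp
  moreover have "min_cone P l = convex_cone hull F"
    using q l by (rule min_cone_positive_combination[OF F])
  ultimately show ?thesis
    by (simp add: box_coeff_def ray_gens_cone[OF F])
qed

lemma age_positive_combination:
  assumes F: "F face_of P" "F \<noteq> P" and q: "\<And>b. b \<in> vertices F \<Longrightarrow> 0 < q b"
    and l: "l = (\<Sum>b\<in>vertices F. q b *\<^sub>R b)"
  shows "age P l = sum q (vertices F)"
proof -
  have "min_cone P l = convex_cone hull F"
    using q l by (rule min_cone_positive_combination[OF F])
  moreover have "box_coeff P l b = q b" if "b \<in> vertices F" for b
    using q l that by (rule box_coeff_positive_combination[OF F])
  ultimately show ?thesis
    by (simp add: age_def ray_gens_cone[OF F])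
qed

lemma dim_cone:
  assumes F: "F face_of P" "F \<noteq> P"
  shows "dim (convex_cone hull F) = card (vertices F)"
proof (rule dim_unique)
  show "vertices F \<subseteq> convex_cone hull F"
    using hull_vertices[OF F] hull_subset[of "vertices F" convex] hull_subset[of F convex_cone] by auto
  show "convex_cone hull F \<subseteq> span (vertices F)"
  proof
    fix x assume "x \<in> convex_cone hull F"
    then obtain c where "x = (\<Sum>v\<in>vertices F. c v *\<^sub>R v)"
      using cone_face_coefficients[OF F] by metis
    then show "x \<in> span (vertices F)"
      by (simp add: span_sum span_scale span_base)
  qed
qed (use independent_vertices[OF F] in auto)

end

text \<open>
  The coefficients of \<open>l\<close> and of its inverse over the vertices of the same face are \<open>q\<^sub>b\<close> and
  \<open>1 - q\<^sub>b\<close>, both positive, so the two labels have the same minimal cone and the two ages add up to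
  the number of vertices.  In terms of the sector this is \<open>n\<^sub>l + i\<^sub>l + i\<^sub>l\<^sub>' = n\<close>, with \<open>l'\<close> the inverse
  label.
\<close>

lemma
  fixes P :: "(real ^ 'n) set"
  assumes "simplicial_polytope P" "0 \<in> interior P" and l: "l \<in> sector_labels P"
  shows age_add_age_inverse: "age P l + age P (inverse_label P l) = dim (min_cone P l)"
    and min_cone_in_fan: "min_cone P l \<in> polytope_fan P"
proof -
  interpret simplicial_polytope_around_0 P
    using assms by unfold_locales
  from l obtain F where F: "F face_of P" "F \<noteq> P" and box: "l \<in> cone_box P (convex_cone hull F)"
    by (auto simp: sector_labels_def polytope_fan_def)
  obtain q where q: "\<And>b. b \<in> vertices F \<Longrightarrow> 0 < q b \<and> q b < 1"
    and lq: "l = (\<Sum>b\<in>vertices F. q b *\<^sub>R b)"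
    using box by (auto simp: cone_box_def ray_gens_cone[OF F])
  have cone: "min_cone P l = convex_cone hull F"
    using q lq by (intro min_cone_positive_combination[OF F]) auto
  then show "min_cone P l \<in> polytope_fan P"
    using F by (auto simp: polytope_fan_def)
  have "inverse_label P l = (\<Sum>b\<in>vertices F. (1 - q b) *\<^sub>R b)"
    unfolding inverse_label_def cone ray_gens_cone[OF F]
    using box_coeff_positive_combination[OF F _ lq] q by (intro sum.cong) auto
  then have "age P (inverse_label P l) = (\<Sum>b\<in>vertices F. 1 - q b)"
    using q by (intro age_positive_combination[OF F]) auto
  moreover have "age P l = sum q (vertices F)"
    using q lq by (intro age_positive_combination[OF F]) auto
  ultimately show "age P l + age P (inverse_label P l) = dim (min_cone P l)"
    by (simp add: cone dim_cone[OF F] sum_subtractf)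
qed

text \<open>
  The quotient fan of a cone of the fan contains the image of that cone itself, so there is at least
  one affine chart.
\<close>

lemma sector_nonempty:
  assumes "min_cone P l \<in> polytope_fan P"
  shows "topspace (sector P l) \<noteq> {}"
proof -
  have "convex (min_cone P l)"
    using assms by (auto simp: polytope_fan_def convex_convex_cone_hull)
  then have "quotient_proj (min_cone P l) ` min_cone P l \<in> quotient_fan (polytope_fan P) (min_cone P l)"
    unfolding quotient_fan_def using assms by (blast intro: face_of_refl)
  then show ?thesis
    unfolding sector_def by (intro topspace_toric_variety_nonempty) blast
qed

section \<open>Bidegrees in orbifold cohomology\<close>

definition nonintegral_shift :: "(real ^ 'n) set \<Rightarrow> real ^ 'n \<Rightarrow> int" where
  "nonintegral_shift P l = (if age P l \<in> \<int> then 0 else 1)"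

text \<open>
  The largest \<open>p\<close> with the summand in \<open>F\<^sup>p\<close>; the shift and the integer part combine the two cases of
  the filtration into one formula.
\<close>

definition hodge_level :: "(real ^ 'n) set \<Rightarrow> (real ^ 'n) \<times> nat \<Rightarrow> int" where
  "hodge_level P = (\<lambda>(l, j). int CARD('n) - nonintegral_shift P l - int j - \<lfloor>age P l\<rfloor>)"

text \<open>
  The smallest \<open>m\<close> with the summand in \<open>W\<^sub>m\<close>.
\<close>

definition weight_level :: "(real ^ 'n) set \<Rightarrow> (real ^ 'n) \<times> nat \<Rightarrow> int" where
  "weight_level P = (\<lambda>(l, j). int CARD('n) - nonintegral_shift P l + int (sector_dim P l) - 2 * int j)"

lemma hodge_filtration_MHS_orb:
  "hodge_filtration (MHS_orb P \<kappa>) p =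
     partial_sum (orb_index P) (orb_summand P) {i. p \<le> hodge_level P i}"
proof -
  have "j \<in> hodge_degrees P p l \<longleftrightarrow> p \<le> hodge_level P (l, j)" for l j
  proof (cases "age P l \<in> \<int>")
    case True
    then obtain a where a: "age P l = of_int a" by (auto elim: Ints_cases)
    have "real j = real CARD('a) - of_int i - of_int a \<longleftrightarrow> i = int CARD('a) - int j - a" for i
      by linarith
    with a True show ?thesis
      by (auto simp: hodge_degrees_def hodge_level_def nonintegral_shift_def)
  next
    case False
    have "int j = int CARD('a) - 1 - i - \<lfloor>age P l\<rfloor> \<longleftrightarrow> i = int CARD('a) - 1 - int j - \<lfloor>age P l\<rfloor>" for i
      by linarith
    with False show ?thesis
      by (auto simp: hodge_degrees_def hodge_level_def nonintegral_shift_def)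
  qed
  then have "{(l, j). j \<in> hodge_degrees P p l} = {i. p \<le> hodge_level P i}" by auto
  then show ?thesis
    by (simp add: MHS_orb_def orb_hodge_filtration_def orb_part_def)
qed

lemma weight_filtration_MHS_orb:
  "weight_filtration (MHS_orb P \<kappa>) m =
     partial_sum (orb_index P) (orb_summand P) {i. weight_level P i \<le> m}"
proof -
  have "j \<in> weight_degrees P m l \<longleftrightarrow> weight_level P (l, j) \<le> m" for l j
    by (auto simp: weight_degrees_def weight_level_def nonintegral_shift_def)
  then have "{(l, j). j \<in> weight_degrees P m l} = {i. weight_level P i \<le> m}" by auto
  then show ?thesis
    by (simp add: MHS_orb_def orb_weight_filtration_def orb_part_def)
qed

text \<open>
  The difference \<open>p - q\<close> of the bidegree of \<open>H\<^sup>2\<^sup>j(X\<^sub>l)\<close> is independent of \<open>j\<close>.  Since the two ages add up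
  to an integer, passing from \<open>l\<close> to its inverse turns the floor of the age into a ceiling, and the
  shift by one for nonintegral ages is exactly the difference between ceiling and floor.
\<close>

lemma bidegree_difference:
  fixes P :: "(real ^ 'n) set"
  assumes "simplicial_polytope P" "0 \<in> interior P" "l \<in> sector_labels P"
  shows "2 * hodge_level P (l, j) - weight_level P (l, j) =
    \<lfloor>age P (inverse_label P l)\<rfloor> - \<lfloor>age P l\<rfloor>"
proof -
  define d where "d = dim (min_cone P l)"
  have "age P (inverse_label P l) = of_int (int d) - age P l"
    using age_add_age_inverse[OF assms] by (simp add: d_def)
  then have "\<lfloor>age P (inverse_label P l)\<rfloor> = int d - \<lceil>age P l\<rceil>"
    by linarith
  moreover have "\<lceil>age P l\<rceil> = \<lfloor>age P l\<rfloor> + nonintegral_shift P l"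
  proof (cases "age P l \<in> \<int>")
    case True
    then obtain a where "age P l = of_int a" by (rule Ints_cases)
    with True show ?thesis by (simp add: nonintegral_shift_def)
  next
    case False
    then have "age P l \<noteq> of_int \<lfloor>age P l\<rfloor>" by (metis Ints_of_int)
    with False show ?thesis by (simp add: nonintegral_shift_def ceiling_altdef)
  qed
  moreover have "int (sector_dim P l) = int CARD('n) - int d"
    using dim_subset_UNIV[of "min_cone P l"] by (simp add: sector_dim_def d_def)
  ultimately show ?thesis
    by (simp add: hodge_level_def weight_level_def)
qed

theorem corollary3p16:
  fixes P :: "(real ^ 'n) set"
    and \<kappa> :: "'n orb_class \<Rightarrow> 'n orb_class"
  assumes "lattice_polytope P"
    and "simplicial_polytope P"
    and "0 \<in> interior P"
    and "poincare_lefschetz_conjugation P \<kappa>"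
  shows "hodge_tate (MHS_orb P \<kappa>) \<longleftrightarrow>
    (\<forall>l\<in>sector_labels P. \<lfloor>age P l\<rfloor> = \<lfloor>age P (inverse_label P l)\<rfloor>)"
proof -
  let ?trivial = "\<lambda>i. carrier (orb_summand P i) \<subseteq> {\<zero>\<^bsub>orb_summand P i\<^esub>}"
  have "hodge_tate (MHS_orb P \<kappa>) \<longleftrightarrow>
      (\<forall>i\<in>orb_index P. 2 * hodge_level P i \<noteq> weight_level P i \<longrightarrow> ?trivial i)"
  proof (rule hodge_tate_split_iff)
    show "space (MHS_orb P \<kappa>) = direct_sum_module (orb_index P) (orb_summand P)"
      by (simp add: MHS_orb_def orb_cohomology_def)
    show "abelian_group (orb_summand P i)" for i
      by (cases i) (simp add: orb_summand_def abelian_group_cohomology)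
  qed (rule hodge_filtration_MHS_orb weight_filtration_MHS_orb)+
  also have "\<dots> \<longleftrightarrow> (\<forall>l\<in>sector_labels P. \<forall>j.
      \<lfloor>age P l\<rfloor> \<noteq> \<lfloor>age P (inverse_label P l)\<rfloor> \<longrightarrow> ?trivial (l, j))"
  proof -
    have "2 * hodge_level P (l, j) \<noteq> weight_level P (l, j) \<longleftrightarrow>
        \<lfloor>age P l\<rfloor> \<noteq> \<lfloor>age P (inverse_label P l)\<rfloor>" if "l \<in> sector_labels P" for l j
      using bidegree_difference[OF assms(2,3) that, of j] by auto
    then show ?thesis unfolding orb_index_def by simp
  qed
  also have "\<dots> \<longleftrightarrow> (\<forall>l\<in>sector_labels P. \<lfloor>age P l\<rfloor> = \<lfloor>age P (inverse_label P l)\<rfloor>)"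
  proof -
    \<comment> \<open>\<open>H\<^sup>0\<close> detects every sector, so no label can be exempt from the condition.\<close>
    have "\<not> ?trivial (l, 0)" if "l \<in> sector_labels P" for l
      using cohomology_0_nontrivial[OF sector_nonempty[OF min_cone_in_fan[OF assms(2,3) that]]]
      by (simp add: orb_summand_def)
    then show ?thesis by blast
  qed
  finally show ?thesis .
qed

end
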